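(* Let $\alpha\neq0$ be a simple root of $f(x)=0$ (so $f'(\alpha)\ne0$) with $f''(\alpha)\neq 0$, and let $q\neq 0$ be a real number. Suppose that the curvature $\mu_q$ of $g$ satisfies $$|\mu_q(\alpha^q)|\le\frac{|f''(\alpha)|}{(q\alpha^{q-1})^2\left(1+\left(\frac{f'(\alpha)}{q\alpha^{q-1}}\right)^2\right)^{3/2}} .$$ Then the convergence to $\alpha$ of the $q$th power of the binomial expansion of Newton's method (of any truncation order $N\ge1$) is equal to or faster than that of Newton's method.
   Context: $f$ is a real function of a real variable, $C^2$ near $\alpha$, and $g(t)=f(t^{1/q})$, so $g(x^q)=f(x)$; its curvature is $\mu_q(t)=\frac{g''(t)}{(1+g'(t)^2)^{3/2}}$. Newton's method is $x_{k+1}=x_k-\frac{f(x_k)}{f'(x_k)}$. For an integer $N\ge1$, the $q$th power of the binomial expansion of Newton's method of truncation order $N$ is the recurrence $$x_{k+1}^q=\sum_{i=0}^{N}\binom{q}{i}x_k^{q-i}\left[-\frac{f(x_k)}{f'(x_k)}\right]^i,\qquad \binom{q}{i}=\frac{q(q-1)\cdots(q-i+1)}{i!}.$$ Real powers occurring are assumed to be defined as real numbers (e.g. positive base), and $t\mapsto t^{1/q}$ is the inverse of $x\mapsto x^q$ near $\alpha$. If a method has the form $x_{k+1}=\varphi(x_k)$, its asymptotic error constant at $\alpha$ is $\lim_{x\to\alpha}|\varphi(x)-\alpha|/(x-\alpha)^2$. "The convergence of method A to $\alpha$ is equal to or faster than that of method B" means that both methods converge to $\alpha$ from every initial value sufficiently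 close to $\alpha$, and the asymptotic error constant of A is at most that of B. *)

theory Defs
  imports "HOL-Analysis.Analysis"
begin

text \<open>
  Real powers \<open>x\<^sup>q\<close> with real exponent. For \<open>x < 0\<close> the power is a real number when
  \<open>q = m / n\<close> with integers \<open>m\<close>, \<open>n\<close> and \<open>n\<close> odd; its sign is then \<open>(-1)\<^sup>m\<close>, and the parity of
  \<open>m\<close> does not depend on the chosen representation. Values outside \<open>rpow_defined\<close> are junk.
\<close>

definition rpow_defined :: "real \<Rightarrow> real \<Rightarrow> bool" where
  "rpow_defined x q \<longleftrightarrow>
     x > 0 \<or> (x < 0 \<and> (\<exists>m n :: int. odd n \<and> q = of_int m / of_int n))"

definition rpow :: "real \<Rightarrow> real \<Rightarrow> real" where
  "rpow x q =
     (if x < 0 \<and> \<not> (\<exists>m n :: int. even m \<and> odd n \<and> q = of_int m / of_int n)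
      then - (\<bar>x\<bar> powr q) else \<bar>x\<bar> powr q)"

lemma rpow_pos: "x > 0 \<Longrightarrow> rpow x q = x powr q"
  by (simp add: rpow_def)

lemma rpow_of_int:
  assumes "x \<noteq> 0"
  shows "rpow x (of_int k) = x powi k"
proof -
  have parity: "(\<exists>m n :: int. even m \<and> odd n \<and> real_of_int k = of_int m / of_int n) \<longleftrightarrow> even k"
  proof
    assume "\<exists>m n :: int. even m \<and> odd n \<and> real_of_int k = of_int m / of_int n"
    then obtain m n :: int where mn: "even m" "odd n" "real_of_int k = of_int m / of_int n"
      by blast
    from mn(2) have "real_of_int n \<noteq> 0" by auto
    with mn(3) have "real_of_int k * of_int n = of_int m" by simp
    then have "k * n = m" by (metis of_int_eq_iff of_int_mult)
    with mn(1,2) show "even k" by (metis even_mult_iff)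
  next
    assume "even k"
    then have "even k \<and> odd (1::int) \<and> real_of_int k = of_int k / of_int 1" by simp
    then show "\<exists>m n :: int. even m \<and> odd n \<and> real_of_int k = of_int m / of_int n"
      by blast
  qed
  have abs: "\<bar>x\<bar> powr of_int k = \<bar>x\<bar> powi k"
    by (rule powr_real_of_int') (use assms in auto)
  show ?thesis
  proof (cases "x < 0")
    case True
    have "(- \<bar>x\<bar>) powi k = (if even k then \<bar>x\<bar> powi k else - (\<bar>x\<bar> powi k))"
      by (rule power_int_minus_left)
    moreover have "- \<bar>x\<bar> = x"
      using True by simp
    ultimately have "x powi k = (if even k then \<bar>x\<bar> powi k else - (\<bar>x\<bar> powi k))"
      by (simp only:)
    then show ?thesis
      unfolding rpow_def parity abs using True by (cases "even k") (simp_all only: simp_thms if_True if_False)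
  next
    case False
    then have "\<bar>x\<bar> = x" by simp
    then show ?thesis
      unfolding rpow_def parity abs using False by (simp only: simp_thms if_False)
  qed
qed

definition C2_near :: "(real \<Rightarrow> real) \<Rightarrow> real \<Rightarrow> bool" where
  "C2_near f \<alpha> \<longleftrightarrow>
     (\<exists>S. open S \<and> \<alpha> \<in> S \<and>
          (\<forall>x\<in>S. f differentiable (at x) \<and> deriv f differentiable (at x)) \<and>
          continuous_on S (deriv (deriv f)))"

text \<open>
  \<open>r\<close> is the function \<open>t \<mapsto> t\<^sup>1\<^sup>/\<^sup>q\<close>, i.e. the branch that inverts \<open>x \<mapsto> x\<^sup>q\<close> near \<open>\<alpha>\<close>; for
  \<open>\<alpha> > 0\<close> one may take \<open>r t = t powr (1 / q)\<close>, whereas for \<open>\<alpha> < 0\<close> and \<open>q = 2\<close> it is \<open>- sqrt t\<close>.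
\<close>

definition root_branch :: "(real \<Rightarrow> real) \<Rightarrow> real \<Rightarrow> real \<Rightarrow> bool" where
  "root_branch r q \<alpha> \<longleftrightarrow> (\<forall>\<^sub>F x in nhds \<alpha>. r (rpow x q) = x)"

lemma root_branch_pos:
  assumes "\<alpha> > 0" "q \<noteq> 0"
  shows "root_branch (\<lambda>t. t powr (1 / q)) q \<alpha>"
proof -
  have "\<forall>\<^sub>F x in nhds \<alpha>. x \<in> {0<..}"
    using assms by (intro eventually_nhds_in_open) auto
  then show ?thesis
    unfolding root_branch_def
    by (rule eventually_mono) (use assms in \<open>simp add: rpow_pos powr_powr\<close>)
qed

definition curvature :: "(real \<Rightarrow> real) \<Rightarrow> real \<Rightarrow> real" where
  "curvature g t = deriv (deriv g) t / (1 + (deriv g t)\<^sup>2) powr (3 / 2)"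

definition newton_step :: "(real \<Rightarrow> real) \<Rightarrow> real \<Rightarrow> real" where
  "newton_step f x = x - f x / deriv f x"

definition newton_ok :: "(real \<Rightarrow> real) \<Rightarrow> real \<Rightarrow> bool" where
  "newton_ok f x \<longleftrightarrow> f differentiable (at x) \<and> deriv f x \<noteq> 0"

definition binomial_newton_sum :: "real \<Rightarrow> nat \<Rightarrow> (real \<Rightarrow> real) \<Rightarrow> real \<Rightarrow> real" where
  "binomial_newton_sum q N f x =
     (\<Sum>i = 0..N. (q gchoose i) * rpow x (q - real i) * (- (f x / deriv f x)) ^ i)"

definition power_newton_step ::
    "(real \<Rightarrow> real) \<Rightarrow> real \<Rightarrow> nat \<Rightarrow> (real \<Rightarrow> real) \<Rightarrow> real \<Rightarrow> real" where
  "power_newton_step r q N f x = r (binomial_newton_sum q N f x)"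

text \<open>
  The step from \<open>x\<close> makes sense: all quantities in the recurrence exist, and the new iterate \<open>y\<close>
  does satisfy the recurrence, which prescribes \<open>y\<^sup>q\<close> (\<open>r\<close> inverts the power only locally).
\<close>

definition power_newton_ok ::
    "(real \<Rightarrow> real) \<Rightarrow> real \<Rightarrow> nat \<Rightarrow> (real \<Rightarrow> real) \<Rightarrow> real \<Rightarrow> bool" where
  "power_newton_ok r q N f x \<longleftrightarrow>
     newton_ok f x \<and> rpow_defined x q \<and> rpow_defined (power_newton_step r q N f x) q \<and>
     rpow (power_newton_step r q N f x) q = binomial_newton_sum q N f x"

text \<open>
  A method is an iteration function \<open>\<phi>\<close> with a predicate \<open>D\<close> telling where its step is defined;
  convergence includes that every iterate is defined.
\<close>

definition converges_near :: "(real \<Rightarrow> bool) \<Rightarrow> (real \<Rightarrow> real) \<Rightarrow> real \<Rightarrow> bool" where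
  "converges_near D \<phi> \<alpha> \<longleftrightarrow>
     (\<exists>\<delta>>0. \<forall>x0. \<bar>x0 - \<alpha>\<bar> < \<delta> \<longrightarrow>
        (\<forall>k. D ((\<phi> ^^ k) x0)) \<and> (\<lambda>k. (\<phi> ^^ k) x0) \<longlonglongrightarrow> \<alpha>)"

definition has_asymptotic_error_constant :: "(real \<Rightarrow> real) \<Rightarrow> real \<Rightarrow> real \<Rightarrow> bool" where
  "has_asymptotic_error_constant \<phi> \<alpha> c \<longleftrightarrow>
     ((\<lambda>x. \<bar>\<phi> x - \<alpha>\<bar> / (x - \<alpha>)\<^sup>2) \<longlongrightarrow> c) (at \<alpha>)"

definition converges_equal_or_faster ::
    "(real \<Rightarrow> bool) \<Rightarrow> (real \<Rightarrow> real) \<Rightarrow> (real \<Rightarrow> bool) \<Rightarrow> (real \<Rightarrow> real) \<Rightarrow> real \<Rightarrow> bool" where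
  "converges_equal_or_faster D\<^sub>A \<phi>\<^sub>A D\<^sub>B \<phi>\<^sub>B \<alpha> \<longleftrightarrow>
     converges_near D\<^sub>A \<phi>\<^sub>A \<alpha> \<and> converges_near D\<^sub>B \<phi>\<^sub>B \<alpha> \<and>
     (\<exists>a b. has_asymptotic_error_constant \<phi>\<^sub>A \<alpha> a \<and>
            has_asymptotic_error_constant \<phi>\<^sub>B \<alpha> b \<and> a \<le> b)"

end

theory Submission imports Defs begin

text \<open>
  Write \<open>P x = x\<^sup>q\<close>. Newton's method has the signed error constant
  \<open>f''(\<alpha>) / (2 f'(\<alpha>))\<close>. The truncated binomial sum is \<open>P (\<alpha>)\<close> plus
  \<open>P' (x)\<close> times the Newton error, minus the second order remainder of \<open>P\<close>, plus the terms of
  index \<open>i \<ge> 2\<close>. For \<open>N \<ge> 2\<close> the term with \<open>i = 2\<close> cancels the remainder to second order, so both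
  methods have the same constant; for \<open>N = 1\<close> the remainder survives and, after dividing by
  \<open>P' (\<alpha>)\<close>, changes the constant to \<open>(f''(\<alpha>) - (q - 1) f'(\<alpha>) / \<alpha>) / (2 f'(\<alpha>))\<close>. The same
  numerator is \<open>P' (\<alpha>)\<^sup>2\<close> times the second derivative of the transported function at
  \<open>\<alpha>\<^sup>q\<close>, so the curvature hypothesis bounds it by \<open>f''(\<alpha>)\<close> in absolute value.
\<close>

section \<open>Second-order remainders and local convergence\<close>

text \<open>This is the Taylor remainder expanded at the moving point \<open>x\<close>. In the
  derivative of the numerator the \<open>F'\<close> terms cancel, so one use of L'Hopital's rule
  suffices. It serves for \<open>f\<close>, where the numerator is the Newton error times
  \<open>deriv f x\<close>, and for the power function.\<close>

lemma tendsto_second_order_remainder: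
  fixes F F' F'' :: "real \<Rightarrow> real"
  assumes F: "\<forall>\<^sub>F x in nhds a. (F has_real_derivative F' x) (at x)"
    and F': "\<forall>\<^sub>F x in nhds a. (F' has_real_derivative F'' x) (at x)"
    and F'': "isCont F'' a"
  shows "((\<lambda>x. (F' x * (x - a) - (F x - F a)) / (x - a)\<^sup>2) \<longlongrightarrow> F'' a / 2) (at a)"
proof (rule lhopital)
  have C: "isCont F a" "isCont F' a"
    using F F' by (auto dest!: eventually_nhds_x_imp_x intro: DERIV_isCont)
  show "(\<lambda>x. F' x * (x - a) - (F x - F a)) \<midarrow>a\<rightarrow> 0"
    by (rule tendsto_eq_intros C[unfolded isCont_def] refl | simp)+
  show "(\<lambda>x. (x - a)\<^sup>2) \<midarrow>a\<rightarrow> 0"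
    by (rule tendsto_eq_intros refl | simp)+
  show "\<forall>\<^sub>F x in at a. (x - a)\<^sup>2 \<noteq> 0" "\<forall>\<^sub>F x in at a. 2 * (x - a) \<noteq> 0"
    by (auto simp: eventually_at_filter)
  show "\<forall>\<^sub>F x in at a.
      ((\<lambda>x. F' x * (x - a) - (F x - F a)) has_real_derivative F'' x * (x - a)) (at x)"
    using F[THEN filter_leD[OF at_within_le_nhds]] F'[THEN filter_leD[OF at_within_le_nhds]]
    by eventually_elim (auto intro!: derivative_eq_intros)
  show "\<forall>\<^sub>F x in at a. ((\<lambda>x. (x - a)\<^sup>2) has_real_derivative 2 * (x - a)) (at x)"
    by (intro always_eventually) (auto intro!: derivative_eq_intros)
  have "(\<lambda>x. F'' x / 2) \<midarrow>a\<rightarrow> F'' a / 2"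
    using F'' by (auto simp: isCont_def intro: tendsto_intros)
  then show "(\<lambda>x. F'' x * (x - a) / (2 * (x - a))) \<midarrow>a\<rightarrow> F'' a / 2"
    by (rule Lim_transform_eventually)
      (auto simp: eventually_at_filter simp del: right_diff_distrib_numeral)
qed

text \<open>A finite error constant makes \<phi> at least halve the distance to \<alpha> on some
  interval around \<alpha>. The interval is then invariant, so every iterate satisfies
  \<open>D\<close> and the errors decay geometrically. The fixed point is a separate hypothesis
  because a limit at \<alpha> says nothing about the value there.\<close>

lemma converges_near_quadratic:
  assumes D: "\<forall>\<^sub>F x in nhds \<alpha>. D x"
    and fixpoint: "\<phi> \<alpha> = \<alpha>"
    and c: "has_asymptotic_error_constant \<phi> \<alpha> c"
  shows "converges_near D \<phi> \<alpha>"
proof -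
  \<comment> \<open>Off \<alpha> this product is the contraction ratio; its limit is 0, and 1/2 is a
    convenient bound below 1.\<close>
  have "((\<lambda>x. \<bar>\<phi> x - \<alpha>\<bar> / (x - \<alpha>)\<^sup>2 * \<bar>x - \<alpha>\<bar>) \<longlongrightarrow> c * \<bar>\<alpha> - \<alpha>\<bar>) (at \<alpha>)"
    using c unfolding has_asymptotic_error_constant_def by (intro tendsto_intros)
  then have "\<forall>\<^sub>F x in at \<alpha>. \<bar>\<phi> x - \<alpha>\<bar> / (x - \<alpha>)\<^sup>2 * \<bar>x - \<alpha>\<bar> < 1 / 2"
    by (rule order_tendstoD) simp
  then have "\<forall>\<^sub>F x in nhds \<alpha>. x \<noteq> \<alpha> \<longrightarrow> \<bar>\<phi> x - \<alpha>\<bar> / (x - \<alpha>)\<^sup>2 * \<bar>x - \<alpha>\<bar> < 1 / 2"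
    by (simp add: eventually_at_filter)
  with D have "\<forall>\<^sub>F x in nhds \<alpha>. D x \<and> \<bar>\<phi> x - \<alpha>\<bar> \<le> \<bar>x - \<alpha>\<bar> / 2"
  proof eventually_elim
    case (elim x)
    show ?case
    proof (cases "x = \<alpha>")
      case False
      have "b / \<bar>x - \<alpha>\<bar>\<^sup>2 * \<bar>x - \<alpha>\<bar> = b / \<bar>x - \<alpha>\<bar>" for b
        using False by (simp add: power2_eq_square del: abs_mult_self_eq)
      then have "b / (x - \<alpha>)\<^sup>2 * \<bar>x - \<alpha>\<bar> = b / \<bar>x - \<alpha>\<bar>" for b
        by simp
      with elim(2) False have "\<bar>\<phi> x - \<alpha>\<bar> / \<bar>x - \<alpha>\<bar> < 1 / 2" by metis
      with elim(1) False show ?thesis by (simp add: pos_divide_less_eq)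
    qed (use elim fixpoint in auto)
  qed
  then obtain \<delta> where "\<delta> > 0"
    and \<delta>: "\<And>x. \<bar>x - \<alpha>\<bar> < \<delta> \<Longrightarrow> D x \<and> \<bar>\<phi> x - \<alpha>\<bar> \<le> \<bar>x - \<alpha>\<bar> / 2"
    unfolding eventually_nhds_metric dist_real_def by blast
  have "(\<forall>k. D ((\<phi> ^^ k) x)) \<and> (\<lambda>k. (\<phi> ^^ k) x) \<longlonglongrightarrow> \<alpha>" if x: "\<bar>x - \<alpha>\<bar> < \<delta>" for x
  proof -
    have *: "\<bar>(\<phi> ^^ k) x - \<alpha>\<bar> \<le> \<bar>x - \<alpha>\<bar> * (1 / 2) ^ k" for k
    proof (induction k)
      case (Suc k)
      \<comment> \<open>The geometric bound also keeps the current iterate within \<delta>, where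
        halving applies once more.\<close>
      have "\<bar>x - \<alpha>\<bar> * (1 / 2) ^ k \<le> \<bar>x - \<alpha>\<bar>"
        by (intro mult_left_le) (auto simp: power_le_one)
      with Suc x have "\<bar>(\<phi> ^^ k) x - \<alpha>\<bar> < \<delta>" by linarith
      from \<delta>[OF this] Suc show ?case by simp
    qed simp
    have "\<bar>(\<phi> ^^ k) x - \<alpha>\<bar> < \<delta>" for k
    proof -
      have "\<bar>x - \<alpha>\<bar> * (1 / 2) ^ k \<le> \<bar>x - \<alpha>\<bar>"
        by (intro mult_left_le) (auto simp: power_le_one)
      with *[of k] x show ?thesis by linarith
    qed
    moreover have "(\<lambda>k. \<bar>x - \<alpha>\<bar> * (1 / 2) ^ k) \<longlonglongrightarrow> 0"
      by (intro tendsto_mult_right_zero LIMSEQ_power_zero) simp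
    then have "(\<lambda>k. (\<phi> ^^ k) x - \<alpha>) \<longlonglongrightarrow> 0"
      by (rule Lim_null_comparison[rotated]) (use * in auto)
    ultimately show ?thesis
      using \<delta> by (auto simp: LIM_zero_iff)
  qed
  with \<open>\<delta> > 0\<close> show ?thesis unfolding converges_near_def by blast
qed

section \<open>Real powers of either sign and their derivatives\<close>

text \<open>For \<open>x < 0\<close> and \<open>q = m / n\<close> with \<open>n\<close> odd, the
  exponent \<open>q - i\<close> is \<open>(m - i * n) / n\<close>. Its numerator has the parity of
  \<open>m + i\<close>, so the sign changes exactly as that of \<open>x ^ i\<close>. All powers in
  the binomial sum thus reduce to the single power \<open>rpow x q\<close>.\<close>

lemma rpow_diff_nat:
  assumes "rpow_defined x q"
  shows "rpow x (q - real i) = rpow x q / x ^ i"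
proof (cases "x > 0")
  case True
  then show ?thesis by (simp add: rpow_pos powr_diff powr_realpow)
next
  case False
  with assms obtain m n :: int where x: "x < 0" and n: "odd n" and q: "q = m / n"
    by (auto simp: rpow_defined_def)
  \<comment> \<open>With odd denominators, cross-multiplication shows that the parity of the
    numerator is independent of the representation.\<close>
  have parity: "(\<exists>k l :: int. even k \<and> odd l \<and> p / n = of_int k / of_int l) \<longleftrightarrow> even p" for p :: int
  proof
    assume "\<exists>k l :: int. even k \<and> odd l \<and> p / n = of_int k / of_int l"
    then obtain k l :: int where kl: "even k" "odd l" "p / n = of_int k / of_int l" by blast
    have "real_of_int n \<noteq> 0" "real_of_int l \<noteq> 0" using n kl(2) by auto
    with kl(3) have "real_of_int (p * l) = of_int (k * n)" by (simp add: field_simps)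
    then have "p * l = k * n" by (simp only: of_int_eq_iff)
    with kl show "even p" by (metis even_mult_iff)
  qed (use n in blast)
  have n0: "real_of_int n \<noteq> 0" using n by auto
  have qi: "q - real i = (m - int i * n) / n"
    using n0 by (simp add: q field_simps)
  have "\<bar>x\<bar> powr (q - real i) = \<bar>x\<bar> powr q / \<bar>x\<bar> ^ i"
    using x by (simp add: powr_diff powr_realpow)
  moreover have "\<bar>x\<bar> ^ i = (if even i then x ^ i else - (x ^ i))"
    using x by simp
  moreover have sign: "rpow x (p / n) = (if even p then 1 else -1) * \<bar>x\<bar> powr (p / n)" for p :: int
    unfolding rpow_def parity using x by simp
  have "rpow x (q - real i) = (if even (m - int i * n) then 1 else -1) * \<bar>x\<bar> powr (q - real i)"
    unfolding qi by (rule sign)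
  moreover have "rpow x q = (if even m then 1 else -1) * \<bar>x\<bar> powr q"
    unfolding q by (rule sign)
  ultimately show ?thesis
    using n by auto
qed

text \<open>Writing the derivative as \<open>p\<close> times the power over \<open>x\<close> keeps
  the exponent \<open>p\<close>, so the second derivative needs only this rule and the quotient
  rule. It is applied with \<open>p = q\<close> to the power and with \<open>p = 1 / q\<close> to
  its inverse.\<close>

lemma has_real_derivative_signed_powr:
  fixes c s p x :: real
  assumes "c * x > 0"
  shows "((\<lambda>x. s * (c * x) powr p) has_real_derivative p * (s * (c * x) powr p) / x) (at x)"
proof -
  have "(c * x) powr (p - 1) = (c * x) powr p / (c * x)"
    using assms by (simp add: powr_diff)
  then show ?thesis
    using assms by (auto intro!: derivative_eq_intros)
qed

lemma has_real_derivative_signed_powr':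
  fixes c s p x :: real
  assumes "c * x > 0"
  shows "((\<lambda>x. p * (s * (c * x) powr p) / x) has_real_derivative
           p * (p - 1) * (s * (c * x) powr p) / x\<^sup>2) (at x)"
proof -
  have "x \<noteq> 0" using assms by auto
  then have "((\<lambda>x. p * (s * (c * x) powr p) / x) has_real_derivative
      (p * (p * (s * (c * x) powr p) / x) * x - p * (s * (c * x) powr p) * 1) / (x * x)) (at x)"
    by (intro DERIV_divide DERIV_cmult DERIV_ident has_real_derivative_signed_powr assms)
  then show ?thesis
    by (rule DERIV_cong) (use \<open>x \<noteq> 0\<close> in \<open>simp add: power2_eq_square algebra_simps\<close>)
qed

text \<open>Here \<open>c\<close> is the sign of \<alpha> and \<open>s\<close> the sign of its
  power. On the half-line containing \<alpha> the power then has one smooth formula, and both signs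
  of \<alpha> are treated together.\<close>

lemma rpow_local_form:
  assumes "\<alpha> \<noteq> 0" "rpow_defined \<alpha> q"
  obtains c s :: real where "c * c = 1" "s * s = 1" "c * \<alpha> > 0"
    "\<And>x. c * x > 0 \<Longrightarrow> rpow_defined x q \<and> rpow x q = s * (c * x) powr q"
proof (cases "\<alpha> > 0")
  case True
  then show ?thesis
    by (intro that[of 1 1]) (auto simp: rpow_pos rpow_defined_def)
next
  case False
  define s :: real where "s = (if \<exists>m n :: int. even m \<and> odd n \<and> q = m / n then 1 else -1)"
  show ?thesis
    using assms False
    by (intro that[of "-1" s]) (auto simp: rpow_def rpow_defined_def s_def)
qed

section \<open>The error constant of Newton's method\<close>

lemma C2_nearD:
  assumes "C2_near f \<alpha>"
  shows "\<forall>\<^sub>F x in nhds \<alpha>. (f has_real_derivative deriv f x) (at x)"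
    and "\<forall>\<^sub>F x in nhds \<alpha>. (deriv f has_real_derivative deriv (deriv f) x) (at x)"
    and "isCont (deriv (deriv f)) \<alpha>"
proof -
  obtain S where S: "open S" "\<alpha> \<in> S"
    and d: "\<And>x. x \<in> S \<Longrightarrow> f differentiable (at x) \<and> deriv f differentiable (at x)"
    and c: "continuous_on S (deriv (deriv f))"
    using assms unfolding C2_near_def by blast
  have "\<forall>\<^sub>F x in nhds \<alpha>. x \<in> S" using S by (rule eventually_nhds_in_open)
  then have "\<forall>\<^sub>F x in nhds \<alpha>. f differentiable (at x) \<and> deriv f differentiable (at x)"
    by (rule eventually_mono) (rule d)
  then show "\<forall>\<^sub>F x in nhds \<alpha>. (f has_real_derivative deriv f x) (at x)"
    and "\<forall>\<^sub>F x in nhds \<alpha>. (deriv f has_real_derivative deriv (deriv f) x) (at x)"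
    by (auto elim!: eventually_mono simp: DERIV_deriv_iff_real_differentiable)
  show "isCont (deriv (deriv f)) \<alpha>"
    using S c by (simp add: continuous_on_eq_continuous_at)
qed

lemma newton_step_quotient_tendsto:
  assumes f: "C2_near f \<alpha>" "f \<alpha> = 0" "deriv f \<alpha> \<noteq> 0"
  shows "((\<lambda>x. (newton_step f x - \<alpha>) / (x - \<alpha>)\<^sup>2) \<longlongrightarrow>
           deriv (deriv f) \<alpha> / (2 * deriv f \<alpha>)) (at \<alpha>)"
proof -
  note d = C2_nearD[OF f(1)]
  have cont: "deriv f \<midarrow>\<alpha>\<rightarrow> deriv f \<alpha>"
    using eventually_nhds_x_imp_x[OF d(2)] by (auto dest: DERIV_isCont simp: isCont_def)
  have "((\<lambda>x. (deriv f x * (x - \<alpha>) - (f x - f \<alpha>)) / (x - \<alpha>)\<^sup>2 / deriv f x) \<longlongrightarrow>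
      deriv (deriv f) \<alpha> / 2 / deriv f \<alpha>) (at \<alpha>)"
    by (intro tendsto_intros tendsto_second_order_remainder d cont f(3))
  moreover have "\<forall>\<^sub>F x in at \<alpha>. (deriv f x * (x - \<alpha>) - (f x - f \<alpha>)) / (x - \<alpha>)\<^sup>2 / deriv f x
      = (newton_step f x - \<alpha>) / (x - \<alpha>)\<^sup>2"
    using tendsto_imp_eventually_ne[OF cont f(3)]
    by eventually_elim (simp add: newton_step_def f(2) field_simps)
  ultimately show ?thesis
    by (auto elim: Lim_transform_eventually)
qed

section \<open>The inverse branch and the transported function\<close>

text \<open>A left inverse near \<alpha> is already determined near \<open>T\<close>: the explicit
  inverse \<open>R\<close> is continuous at \<open>T\<close> with \<open>R T = \<alpha>\<close>, so
  \<open>R t\<close> lies where \<open>r\<close> undoes the power, and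
  \<open>r t = r (rpow (R t) q) = R t\<close>. Smoothness of \<open>r\<close> follows without being
  assumed.\<close>

lemma root_branch_local_form:
  assumes r: "root_branch r q \<alpha>" and "q \<noteq> 0"
    and cs: "c * c = 1" "s * s = 1" "c * \<alpha> > 0"
    and rpow: "\<And>x. c * x > 0 \<Longrightarrow> rpow x q = s * (c * x) powr q"
  shows "\<forall>\<^sub>F t in nhds (rpow \<alpha> q). s * t > 0 \<and> r t = c * (s * t) powr (1 / q)"
proof -
  define T where "T = rpow \<alpha> q"
  define R where "R = (\<lambda>t. c * (s * t) powr (1 / q))"
  have ss: "s * (s * y) = y" and cc: "c * (c * y) = y" for y
    using cs by (simp_all flip: mult.assoc)
  have T: "T = s * (c * \<alpha>) powr q" using cs rpow by (simp add: T_def)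
  then have sT: "s * T = (c * \<alpha>) powr q" by (simp add: ss)
  then have pos: "s * T > 0" using cs(3) by auto
  have RT: "R T = \<alpha>" using cs \<open>q \<noteq> 0\<close> by (auto simp: R_def sT powr_powr cc)
  have "isCont R T" unfolding R_def using pos by (intro continuous_intros) auto
  then have "filterlim R (nhds \<alpha>) (nhds T)"
    using RT tendsto_at_iff_tendsto_nhds[of R T] by (simp add: isCont_def)
  then have "\<forall>\<^sub>F t in nhds T. r (rpow (R t) q) = R t"
    using r unfolding root_branch_def by (rule eventually_compose_filterlim[rotated])
  moreover have "\<forall>\<^sub>F t in nhds T. s * t > 0"
    using pos by (intro order_tendstoD(1)[of "\<lambda>t. s * t" "s * T"] tendsto_intros filterlim_ident)
  ultimately show ?thesis
    unfolding T_def[symmetric]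
  proof eventually_elim
    case (elim t)
    have "c * R t = (s * t) powr (1 / q)" by (simp add: R_def cc)
    moreover from this have "c * R t > 0" using elim(2) by auto
    ultimately have "rpow (R t) q = t"
      using elim(2) \<open>q \<noteq> 0\<close> by (simp add: rpow powr_powr ss)
    with elim show ?case by (simp add: R_def)
  qed
qed

text \<open>Near \<open>T\<close> the branch \<open>r\<close> may be replaced by the explicit
  \<open>R\<close>, whose derivative is \<open>R t / (q * t)\<close>; the chain and product rules do
  the rest. The final clause says that \<open>r\<close> is also a right inverse near
  \<open>T\<close>, which guarantees that a new iterate really satisfies the recurrence.\<close>

lemma deriv_transported:
  fixes f r :: "real \<Rightarrow> real"
  assumes f: "C2_near f \<alpha>" and "\<alpha> \<noteq> 0"
    and "q \<noteq> 0"
    and def: "rpow_defined \<alpha> q"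
    and r: "root_branch r q \<alpha>"
  defines "g \<equiv> \<lambda>t. f (r t)" and "T \<equiv> rpow \<alpha> q" and "P' \<equiv> q * rpow \<alpha> (q - 1)"
  shows "P' \<noteq> 0" and "(r has_real_derivative 1 / P') (at T)"
    and "deriv g T = deriv f \<alpha> / P'"
    and "deriv (deriv g) T = (deriv (deriv f) \<alpha> - (q - 1) * deriv f \<alpha> / \<alpha>) / P'\<^sup>2"
    and "\<forall>\<^sub>F t in nhds T. rpow_defined (r t) q \<and> rpow (r t) q = t"
proof -
  obtain c s where cs: "c * c = 1" "s * s = 1" "c * \<alpha> > 0"
    and rp: "\<And>x. c * x > 0 \<Longrightarrow> rpow_defined x q \<and> rpow x q = s * (c * x) powr q"
    using rpow_local_form[OF \<open>\<alpha> \<noteq> 0\<close> def] by blast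
  define R where "R = (\<lambda>t. c * (s * t) powr (1 / q))"
  have ss: "s * (s * y) = y" and cc: "c * (c * y) = y" for y
    using cs by (simp_all flip: mult.assoc)
  have ev: "\<forall>\<^sub>F t in nhds T. s * t > 0 \<and> r t = R t"
    unfolding T_def R_def using root_branch_local_form[OF r \<open>q \<noteq> 0\<close> cs] rp by blast
  have T: "T = s * (c * \<alpha>) powr q" using cs rp by (simp add: T_def)
  then have sT: "s * T = (c * \<alpha>) powr q" by (simp add: ss)
  then have "s * T > 0" using cs(3) by auto
  then have T0: "T \<noteq> 0" by auto
  have RT: "R T = \<alpha>" using cs \<open>q \<noteq> 0\<close> by (auto simp: R_def sT powr_powr cc)
  have P': "P' = q * T / \<alpha>"
    using rpow_diff_nat[OF def, of 1] by (simp add: P'_def T_def)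
  show P'0: "P' \<noteq> 0" using T0 \<open>q \<noteq> 0\<close> \<open>\<alpha> \<noteq> 0\<close> by (simp add: P')
  have dR: "(R has_real_derivative 1 / q * R t / t) (at t)" if "s * t > 0" for t
    unfolding R_def using has_real_derivative_signed_powr[OF that] .
  have dR': "((\<lambda>t. 1 / q * R t / t) has_real_derivative 1 / q * (1 / q - 1) * R t / t\<^sup>2) (at t)"
    if "s * t > 0" for t
    unfolding R_def using has_real_derivative_signed_powr'[OF that] .
  have "(R has_real_derivative 1 / P') (at T)"
    using dR[OF \<open>s * T > 0\<close>] by (simp add: RT P')
  then show "(r has_real_derivative 1 / P') (at T)"
    using DERIV_cong_ev[OF refl eventually_mono[OF ev] refl] by blast
  have "isCont R T" using dR[OF \<open>s * T > 0\<close>] by (rule DERIV_isCont)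
  then have lim: "filterlim R (nhds \<alpha>) (nhds T)"
    using RT tendsto_at_iff_tendsto_nhds[of R T] by (simp add: isCont_def)
  note d = C2_nearD[OF f]
  have ev': "\<forall>\<^sub>F t in nhds T. (f has_real_derivative deriv f (R t)) (at (R t))"
    by (rule eventually_compose_filterlim[OF d(1) lim])
  have gR: "\<forall>\<^sub>F t in nhds T. g t = f (R t)"
    using ev by eventually_elim (simp add: g_def)
  \<comment> \<open>To differentiate \<open>deriv g\<close> at \<open>T\<close>, its formula must
    hold on a neighbourhood; hence \<open>g\<close> has to agree with \<open>f (R t)\<close> around
    every nearby \<open>t\<close>, which is what \<open>eventually_eventually\<close>
    supplies.\<close>
  have dg: "\<forall>\<^sub>F t in nhds T. deriv g t = deriv f (R t) * (1 / q * R t / t)"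
    using ev ev' eventually_eventually[THEN iffD2, OF gR]
  proof eventually_elim
    case (elim t)
    have "((\<lambda>t. f (R t)) has_real_derivative deriv f (R t) * (1 / q * R t / t)) (at t)"
      using elim dR by (intro DERIV_chain2) auto
    then have "(g has_real_derivative deriv f (R t) * (1 / q * R t / t)) (at t)"
      using DERIV_cong_ev[OF refl elim(3) refl] by blast
    then show ?case by (rule DERIV_imp_deriv)
  qed
  from eventually_nhds_x_imp_x[OF dg] show "deriv g T = deriv f \<alpha> / P'"
    by (simp add: RT P')
  have d2: "(deriv f has_real_derivative deriv (deriv f) (R T)) (at (R T))"
    using eventually_nhds_x_imp_x[OF d(2)] by (simp add: RT)
  have "((\<lambda>t. deriv f (R t) * (1 / q * R t / t)) has_real_derivative
      (deriv (deriv f) (R T) * (1 / q * R T / T)) * (1 / q * R T / T)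
      + (1 / q * (1 / q - 1) * R T / T\<^sup>2) * deriv f (R T)) (at T)"
    by (intro DERIV_mult DERIV_chain2[where f = "deriv f" and g = R] d2 dR dR' \<open>s * T > 0\<close>)
  then have "(deriv g has_real_derivative
      (deriv (deriv f) (R T) * (1 / q * R T / T)) * (1 / q * R T / T)
      + (1 / q * (1 / q - 1) * R T / T\<^sup>2) * deriv f (R T)) (at T)"
    using DERIV_cong_ev[OF refl dg refl] by blast
  then have "deriv (deriv g) T =
      (deriv (deriv f) \<alpha> * (1 / q * \<alpha> / T)) * (1 / q * \<alpha> / T)
      + (1 / q * (1 / q - 1) * \<alpha> / T\<^sup>2) * deriv f \<alpha>"
    unfolding RT by (rule DERIV_imp_deriv)
  \<comment> \<open>Substitute \<open>P' = q * T / \<alpha>\<close> and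
    \<open>1 / q * (1 / q - 1) = (1 - q) / q\<^sup>2\<close>.\<close>
  also have "\<dots> = (deriv (deriv f) \<alpha> - (q - 1) * deriv f \<alpha> / \<alpha>) / P'\<^sup>2"
    using \<open>\<alpha> \<noteq> 0\<close> \<open>q \<noteq> 0\<close> T0 unfolding P' by (simp add: field_simps power2_eq_square)
  finally show "deriv (deriv g) T = (deriv (deriv f) \<alpha> - (q - 1) * deriv f \<alpha> / \<alpha>) / P'\<^sup>2" .
  show "\<forall>\<^sub>F t in nhds T. rpow_defined (r t) q \<and> rpow (r t) q = t"
    using ev
  proof eventually_elim
    case (elim t)
    have "c * R t = (s * t) powr (1 / q)" by (simp add: R_def cc)
    moreover from this have "c * R t > 0" using elim by auto
    ultimately show ?case
      using elim \<open>q \<noteq> 0\<close> by (simp add: rp powr_powr ss)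
  qed
qed

section \<open>Error of the binomial sum and of the resulting step\<close>

lemma binomial_newton_sum_quotient_tendsto:
  assumes f: "C2_near f \<alpha>" "f \<alpha> = 0" "deriv f \<alpha> \<noteq> 0"
    and "\<alpha> \<noteq> 0" and def: "rpow_defined \<alpha> q" and "N \<ge> 1"
  shows "((\<lambda>x. (binomial_newton_sum q N f x - rpow \<alpha> q) / (x - \<alpha>)\<^sup>2) \<longlongrightarrow>
     q * rpow \<alpha> (q - 1) *
       (deriv (deriv f) \<alpha> / (2 * deriv f \<alpha>) - (if N = 1 then (q - 1) / (2 * \<alpha>) else 0))) (at \<alpha>)"
proof -
  obtain c s where cs: "c * c = 1" "s * s = 1" "c * \<alpha> > 0"
    and rp: "\<And>x. c * x > 0 \<Longrightarrow> rpow_defined x q \<and> rpow x q = s * (c * x) powr q"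
    using rpow_local_form[OF \<open>\<alpha> \<noteq> 0\<close> def] by blast
  define P where "P = (\<lambda>x. s * (c * x) powr q)"
  define Q where "Q = (\<lambda>x. q * P x / x)"
  define Q' where "Q' = (\<lambda>x. q * (q - 1) * P x / x\<^sup>2)"
  define h where "h = (\<lambda>x. - (f x / deriv f x))"
  define e where "e = (\<lambda>x. newton_step f x - \<alpha>)"
  define K where "K = deriv (deriv f) \<alpha> / (2 * deriv f \<alpha>)"
  have near: "\<forall>\<^sub>F x in nhds \<alpha>. c * x > 0"
    using cs(3) by (intro order_tendstoD(1)[of "\<lambda>x. c * x" "c * \<alpha>"] tendsto_intros filterlim_ident)
  have dP: "(P has_real_derivative Q x) (at x)" if "c * x > 0" for x
    unfolding P_def Q_def using has_real_derivative_signed_powr[OF that] .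
  have dQ: "(Q has_real_derivative Q' x) (at x)" if "c * x > 0" for x
    unfolding P_def Q_def Q'_def using has_real_derivative_signed_powr'[OF that] .
  have contP: "P \<midarrow>\<alpha>\<rightarrow> P \<alpha>" and contQ: "Q \<midarrow>\<alpha>\<rightarrow> Q \<alpha>"
    using dP[OF cs(3)] dQ[OF cs(3)] by (auto dest: DERIV_isCont simp: isCont_def)
  have "isCont Q' \<alpha>"
    unfolding Q'_def isCont_def using \<open>\<alpha> \<noteq> 0\<close> by (intro tendsto_intros contP) auto
  then have lP: "((\<lambda>x. (Q x * (x - \<alpha>) - (P x - P \<alpha>)) / (x - \<alpha>)\<^sup>2) \<longlongrightarrow> Q' \<alpha> / 2) (at \<alpha>)"
    using near by (intro tendsto_second_order_remainder) (auto elim: eventually_mono intro: dP dQ)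
  have le: "((\<lambda>x. e x / (x - \<alpha>)\<^sup>2) \<longlongrightarrow> K) (at \<alpha>)"
    unfolding e_def K_def by (rule newton_step_quotient_tendsto[OF f])
  have h: "h x = e x - (x - \<alpha>)" for x
    by (simp add: e_def h_def newton_step_def)
  \<comment> \<open>Off \<alpha> this is \<open>h x / (x - \<alpha>)\<close>: the Newton correction
    \<open>h\<close> cancels the current error to first order.\<close>
  have "((\<lambda>x. e x / (x - \<alpha>)\<^sup>2 * (x - \<alpha>) - 1) \<longlongrightarrow> K * (\<alpha> - \<alpha>) - 1) (at \<alpha>)"
    by (intro tendsto_intros le)
  then have lh: "((\<lambda>x. h x / (x - \<alpha>)) \<longlongrightarrow> -1) (at \<alpha>)"
    by (rule Lim_transform_eventually[OF tendsto_eq_rhs])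
      (auto simp: eventually_at_filter h diff_divide_distrib power2_eq_square)
  have "((\<lambda>x. h x / (x - \<alpha>) * (x - \<alpha>)) \<longlongrightarrow> -1 * (\<alpha> - \<alpha>)) (at \<alpha>)"
    by (intro tendsto_intros lh)
  then have h0: "(h \<longlongrightarrow> 0) (at \<alpha>)"
    by (rule Lim_transform_eventually[OF tendsto_eq_rhs]) (auto simp: eventually_at_filter)
  define G where "G = (\<lambda>x. (Q x * (x - \<alpha>) - (P x - P \<alpha>)) / (x - \<alpha>)\<^sup>2)"
  \<comment> \<open>The terms with \<open>i \<ge> 2\<close>, already divided by
    \<open>(x - \<alpha>)\<^sup>2\<close>: two factors \<open>h x\<close> absorb the divisor and
    \<open>h x ^ (i - 2)\<close> remains.\<close>
  define tail where
    "tail = (\<lambda>x. \<Sum>i = 2..N. (q gchoose i) * (P x / x ^ i) * ((h x / (x - \<alpha>))\<^sup>2 * h x ^ (i - 2)))"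
  have "(tail \<longlongrightarrow> (\<Sum>i = 2..N. (q gchoose i) * (P \<alpha> / \<alpha> ^ i) * ((-1)\<^sup>2 * 0 ^ (i - 2)))) (at \<alpha>)"
    unfolding tail_def using \<open>\<alpha> \<noteq> 0\<close> by (intro tendsto_intros contP lh h0) auto
  \<comment> \<open>Since \<open>0 ^ 0 = 1\<close>, only \<open>i = 2\<close> survives, with half
    the second derivative of \<open>P\<close>; for \<open>N = 1\<close> the range is empty.\<close>
  also have "(\<Sum>i = 2..N. (q gchoose i) * (P \<alpha> / \<alpha> ^ i) * ((-1)\<^sup>2 * 0 ^ (i - 2)))
      = (\<Sum>i = 2..N. if i = 2 then Q' \<alpha> / 2 else 0)"
    by (intro sum.cong)
      (auto simp: Q'_def gbinomial_prod_rev numeral_2_eq_2 power_0_left fact_numeral)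
  also have "\<dots> = (if N = 1 then 0 else Q' \<alpha> / 2)"
    using \<open>N \<ge> 1\<close> by (auto simp: sum.delta)
  finally have ltail: "(tail \<longlongrightarrow> (if N = 1 then 0 else Q' \<alpha> / 2)) (at \<alpha>)" .
  \<comment> \<open>Off \<alpha> this is the full error quotient:
    \<open>h x = e x - (x - \<alpha>)\<close> splits the linear term, and
    \<open>Q x * (x - \<alpha>)\<close> joins \<open>P x - P \<alpha>\<close> to form
    \<open>G\<close>.\<close>
  have "((\<lambda>x. Q x * (e x / (x - \<alpha>)\<^sup>2) - G x + tail x) \<longlongrightarrow>
      Q \<alpha> * K - Q' \<alpha> / 2 + (if N = 1 then 0 else Q' \<alpha> / 2)) (at \<alpha>)"
    using lP by (intro tendsto_intros contQ le ltail) (simp add: G_def)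
  moreover have "Q \<alpha> * K - Q' \<alpha> / 2 + (if N = 1 then 0 else Q' \<alpha> / 2)
      = Q \<alpha> * (K - (if N = 1 then (q - 1) / (2 * \<alpha>) else 0))"
    using \<open>\<alpha> \<noteq> 0\<close> by (simp add: Q_def Q'_def field_simps power2_eq_square)
  moreover have "Q \<alpha> = q * rpow \<alpha> (q - 1)"
    using rpow_diff_nat[OF def, of 1] rp[OF cs(3)] by (simp add: Q_def P_def)
  ultimately have lim: "((\<lambda>x. Q x * (e x / (x - \<alpha>)\<^sup>2) - G x + tail x) \<longlongrightarrow>
      q * rpow \<alpha> (q - 1) * (K - (if N = 1 then (q - 1) / (2 * \<alpha>) else 0))) (at \<alpha>)"
    by simp
  have "\<forall>\<^sub>F x in at \<alpha>. x \<noteq> \<alpha>" by (auto simp: eventually_at_filter)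
  with near[THEN filter_leD[OF at_within_le_nhds]]
  have "\<forall>\<^sub>F x in at \<alpha>. Q x * (e x / (x - \<alpha>)\<^sup>2) - G x + tail x
      = (binomial_newton_sum q N f x - rpow \<alpha> q) / (x - \<alpha>)\<^sup>2"
  proof eventually_elim
    case (elim x)
    have rpow_i: "rpow x (q - real i) = P x / x ^ i" for i
      using rpow_diff_nat rp[OF elim(1)] by (simp add: P_def)
    have "binomial_newton_sum q N f x = (\<Sum>i = 0..N. (q gchoose i) * (P x / x ^ i) * h x ^ i)"
      by (simp add: binomial_newton_sum_def h_def rpow_i)
    also have "\<dots> = P x + Q x * h x + (\<Sum>i = 2..N. (q gchoose i) * (P x / x ^ i) * h x ^ i)"
      using \<open>N \<ge> 1\<close> by (simp add: sum.atLeast_Suc_atMost Q_def numeral_2_eq_2)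
    also have "(\<Sum>i = 2..N. (q gchoose i) * (P x / x ^ i) * h x ^ i) = tail x * (x - \<alpha>)\<^sup>2"
      unfolding tail_def sum_distrib_right
    proof (intro sum.cong refl)
      fix i assume "i \<in> {2..N}"
      then have "h x ^ i = (h x)\<^sup>2 * h x ^ (i - 2)"
        by (metis atLeastAtMost_iff le_add_diff_inverse power_add)
      then show "(q gchoose i) * (P x / x ^ i) * h x ^ i =
          (q gchoose i) * (P x / x ^ i) * ((h x / (x - \<alpha>))\<^sup>2 * h x ^ (i - 2)) * (x - \<alpha>)\<^sup>2"
        using elim(2) by (simp add: power_divide)
    qed
    finally have "binomial_newton_sum q N f x - rpow \<alpha> q
        = P x + Q x * (e x - (x - \<alpha>)) + tail x * (x - \<alpha>)\<^sup>2 - P \<alpha>"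
      using rp[OF cs(3)] by (simp add: P_def e_def h_def newton_step_def)
    then show ?case
      using elim(2) by (simp add: G_def field_simps)
  qed
  with lim show ?thesis unfolding K_def by (rule Lim_transform_eventually)
qed

lemma power_newton_step_quotient_tendsto:
  assumes f: "C2_near f \<alpha>" "f \<alpha> = 0" "deriv f \<alpha> \<noteq> 0"
    and "\<alpha> \<noteq> 0" and "q \<noteq> 0" and def: "rpow_defined \<alpha> q" and r: "root_branch r q \<alpha>" and "N \<ge> 1"
  shows "((\<lambda>x. (power_newton_step r q N f x - \<alpha>) / (x - \<alpha>)\<^sup>2) \<longlongrightarrow>
     deriv (deriv f) \<alpha> / (2 * deriv f \<alpha>) - (if N = 1 then (q - 1) / (2 * \<alpha>) else 0)) (at \<alpha>)"
    (is "(_ \<longlongrightarrow> ?L) _")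
    and "\<forall>\<^sub>F x in nhds \<alpha>. power_newton_ok r q N f x"
    and "power_newton_step r q N f \<alpha> = \<alpha>"
proof -
  define T where "T = rpow \<alpha> q"
  define S where "S = binomial_newton_sum q N f"
  define P' where "P' = q * rpow \<alpha> (q - 1)"
  note tr = deriv_transported[OF f(1) \<open>\<alpha> \<noteq> 0\<close> \<open>q \<noteq> 0\<close> def r, folded T_def P'_def]
  \<comment> \<open>At the root the correction vanishes, so only the term \<open>i = 0\<close>
    remains.\<close>
  have ST: "S \<alpha> = T"
    by (simp add: S_def T_def binomial_newton_sum_def f(2) power_0_left sum.atLeast_Suc_atMost if_distrib
        sum.delta cong: if_cong)
  have rT: "r T = \<alpha>"
    using r unfolding root_branch_def T_def by (rule eventually_nhds_x_imp_x)
  with ST show "power_newton_step r q N f \<alpha> = \<alpha>"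
    by (simp add: power_newton_step_def S_def)
  have lS: "((\<lambda>x. (S x - T) / (x - \<alpha>)\<^sup>2) \<longlongrightarrow> P' * ?L) (at \<alpha>)"
    unfolding S_def T_def P'_def
    by (rule binomial_newton_sum_quotient_tendsto[OF f \<open>\<alpha> \<noteq> 0\<close> def \<open>N \<ge> 1\<close>])
  have "((\<lambda>x. (S x - T) / (x - \<alpha>)\<^sup>2 * (x - \<alpha>)\<^sup>2 + T) \<longlongrightarrow> P' * ?L * (\<alpha> - \<alpha>)\<^sup>2 + T) (at \<alpha>)"
    by (intro tendsto_intros lS)
  then have "(S \<longlongrightarrow> T) (at \<alpha>)"
    by (rule Lim_transform_eventually[OF tendsto_eq_rhs]) (auto simp: eventually_at_filter)
  then have limS: "filterlim S (nhds T) (nhds \<alpha>)"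
    using ST tendsto_at_iff_tendsto_nhds[of S \<alpha>] by simp
  \<comment> \<open>Caratheodory's form of the derivative transfers the limit through
    \<open>r\<close> without dividing by \<open>S x - T\<close>, which may vanish. The factor
    \<open>1 / P'\<close> cancels the \<open>P'\<close> in the limit for \<open>S\<close>.\<close>
  obtain \<rho> where \<rho>: "\<And>t. r t - r T = \<rho> t * (t - T)" "isCont \<rho> T" "\<rho> T = 1 / P'"
    using tr(2) unfolding CARAT_DERIV by blast
  have "((\<lambda>x. \<rho> (S x) * ((S x - T) / (x - \<alpha>)\<^sup>2)) \<longlongrightarrow> \<rho> T * (P' * ?L)) (at \<alpha>)"
    by (intro tendsto_mult lS isCont_tendsto_compose[OF \<rho>(2) \<open>(S \<longlongrightarrow> T) (at \<alpha>)\<close>])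
  then show "((\<lambda>x. (power_newton_step r q N f x - \<alpha>) / (x - \<alpha>)\<^sup>2) \<longlongrightarrow> ?L) (at \<alpha>)"
    using \<rho>(1)[of "S _"] \<rho>(3) tr(1) rT by (simp add: power_newton_step_def S_def)
  note d = C2_nearD[OF f(1)]
  have "isCont (deriv f) \<alpha>" using eventually_nhds_x_imp_x[OF d(2)] by (rule DERIV_isCont)
  then have "\<forall>\<^sub>F x in nhds \<alpha>. deriv f x \<noteq> 0"
    using f(3) by (intro tendsto_imp_eventually_ne) (auto simp: isCont_def tendsto_at_iff_tendsto_nhds)
  moreover have "\<forall>\<^sub>F x in nhds \<alpha>. rpow_defined x q"
  proof -
    obtain c s where cs: "c * \<alpha> > 0"
      and rp: "\<And>x. c * x > 0 \<Longrightarrow> rpow_defined x q \<and> rpow x q = s * (c * x) powr q"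
      using rpow_local_form[OF \<open>\<alpha> \<noteq> 0\<close> def] by metis
    have "\<forall>\<^sub>F x in nhds \<alpha>. c * x > 0"
      using cs by (intro order_tendstoD(1)[of "\<lambda>x. c * x" "c * \<alpha>"] tendsto_intros filterlim_ident)
    then show ?thesis by eventually_elim (use rp in auto)
  qed
  moreover have "\<forall>\<^sub>F x in nhds \<alpha>. rpow_defined (r (S x)) q \<and> rpow (r (S x)) q = S x"
    by (rule eventually_compose_filterlim[OF tr(5) limS])
  ultimately show "\<forall>\<^sub>F x in nhds \<alpha>. power_newton_ok r q N f x"
    using d(1)
    by eventually_elim
      (auto simp: power_newton_ok_def newton_ok_def power_newton_step_def S_def
        real_differentiable_def)
qed

section \<open>Comparison of the error constants\<close>

lemma has_asymptotic_error_constantI: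
  assumes "((\<lambda>x. (\<phi> x - \<alpha>) / (x - \<alpha>)\<^sup>2) \<longlongrightarrow> c) (at \<alpha>)"
  shows "has_asymptotic_error_constant \<phi> \<alpha> \<bar>c\<bar>"
  using tendsto_rabs[OF assms] by (simp add: has_asymptotic_error_constant_def abs_divide)

theorem theorem4p7:
  fixes f r :: "real \<Rightarrow> real" and \<alpha> q :: real and N :: nat
  assumes "C2_near f \<alpha>"
    and "\<alpha> \<noteq> 0"
    and "f \<alpha> = 0" and "deriv f \<alpha> \<noteq> 0" and "deriv (deriv f) \<alpha> \<noteq> 0"
    and "q \<noteq> 0"
    and "rpow_defined \<alpha> q"
    and "root_branch r q \<alpha>"
    and "\<bar>curvature (\<lambda>t. f (r t)) (rpow \<alpha> q)\<bar>
           \<le> \<bar>deriv (deriv f) \<alpha>\<bar> /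
              ((q * rpow \<alpha> (q - 1))\<^sup>2 *
               (1 + (deriv f \<alpha> / (q * rpow \<alpha> (q - 1)))\<^sup>2) powr (3 / 2))"
    and "N \<ge> 1"
  shows "converges_equal_or_faster
           (power_newton_ok r q N f) (power_newton_step r q N f)
           (newton_ok f) (newton_step f) \<alpha>"
proof -
  define P' where "P' = q * rpow \<alpha> (q - 1)"
  define f1 where "f1 = deriv f \<alpha>"
  define f2 where "f2 = deriv (deriv f) \<alpha>"
  define L where "L = f2 / (2 * f1) - (if N = 1 then (q - 1) / (2 * \<alpha>) else 0)"
  define w where "w = (1 + (f1 / P')\<^sup>2) powr (3 / 2)"
  note tr = deriv_transported[OF assms(1,2,6,7,8), folded P'_def f1_def f2_def]
  note pn = power_newton_step_quotient_tendsto
    [OF assms(1,3,4,2,6,7,8,10), folded f1_def f2_def, folded L_def]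
  have "1 + (f1 / P')\<^sup>2 > 0" by (rule add_pos_nonneg) auto
  then have w: "w > 0" by (simp add: w_def)
  \<comment> \<open>With the derivatives of the transported function inserted, both sides of the
    curvature bound carry the positive factor \<open>P'\<^sup>2 * w\<close> in the denominator;
    cancelling it leaves a comparison of numerators.\<close>
  have "\<bar>(f2 - (q - 1) * f1 / \<alpha>) / P'\<^sup>2 / w\<bar> \<le> \<bar>f2\<bar> / (P'\<^sup>2 * w)"
    using assms(9) unfolding curvature_def P'_def[symmetric] f1_def[symmetric] f2_def[symmetric]
      tr(3,4) w_def .
  then have "\<bar>f2 - (q - 1) * f1 / \<alpha>\<bar> / (P'\<^sup>2 * w) \<le> \<bar>f2\<bar> / (P'\<^sup>2 * w)"
    using w by (simp add: abs_divide abs_mult)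
  then have le: "\<bar>f2 - (q - 1) * f1 / \<alpha>\<bar> \<le> \<bar>f2\<bar>"
    using w tr(1) by (simp add: divide_le_cancel)
  have f1: "f1 \<noteq> 0" using assms(4) by (simp add: f1_def)
  \<comment> \<open>The bound \<open>le\<close> enters only for \<open>N = 1\<close>; for larger
    \<open>N\<close> the two constants coincide.\<close>
  have "\<bar>L\<bar> \<le> \<bar>f2 / (2 * f1)\<bar>"
  proof (cases "N = 1")
    case True
    have "L = (f2 - (q - 1) * f1 / \<alpha>) / (2 * f1)"
      using True f1 assms(2) by (simp add: L_def field_simps)
    with le show ?thesis by (simp add: abs_divide divide_right_mono)
  qed (simp add: L_def)
  moreover have A: "has_asymptotic_error_constant (power_newton_step r q N f) \<alpha> \<bar>L\<bar>"
    by (rule has_asymptotic_error_constantI[OF pn(1)])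
  moreover have B: "has_asymptotic_error_constant (newton_step f) \<alpha> \<bar>f2 / (2 * f1)\<bar>"
    unfolding f1_def f2_def
    by (rule has_asymptotic_error_constantI[OF newton_step_quotient_tendsto[OF assms(1,3,4)]])
  moreover have "\<forall>\<^sub>F x in nhds \<alpha>. newton_ok f x"
    using pn(2) by eventually_elim (simp add: power_newton_ok_def)
  then have "converges_near (newton_ok f) (newton_step f) \<alpha>"
    by (rule converges_near_quadratic[OF _ _ B]) (simp add: newton_step_def assms(3))
  moreover have "converges_near (power_newton_ok r q N f) (power_newton_step r q N f) \<alpha>"
    by (rule converges_near_quadratic[OF pn(2,3) A])
  ultimately show ?thesis
    unfolding converges_equal_or_faster_def by blast
qed

end
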